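(* Let $n\ge 2$, let $\mathcal A$ be a maximal commutative subalgebra of $\mathcal M_d(\mathbb C)$, and let $A,B,A',B'\in\mathcal A$ satisfy $\ker A\cap\ker B=\{0\}$ and $\ker A'\cap\ker B'=\{0\}$. Then $\mathcal F_{A,B}^{\mathcal A}=\mathcal F_{A',B'}^{\mathcal A}$ if and only if $AB'=A'B$.
   Context: For $A,B\in\mathcal A$, $\mathcal F_{A,B}^{\mathcal A}$ is the set of $n\times n$ block Toeplitz matrices $(T_{p-q})_{p,q=0}^{n-1}$ with all $T_j\in\mathcal A$ ($-(n-1)\le j\le n-1$) and $AT_j=BT_{j-n}$ for $j=1,\dots,n-1$. *)

theory Defs
  imports "HOL-Analysis.Analysis"
begin

text \<open>Complex d x d matrices are rendered as complex^'d^'d (d = CARD('d)).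
  Scalar multiplication c X is written as (mat c) ** X.\<close>

definition comm_subalgebra :: "(complex^'d^'d) set \<Rightarrow> bool" where
  "comm_subalgebra S \<longleftrightarrow>
     0 \<in> S \<and>
     (\<forall>X\<in>S. \<forall>Y\<in>S. X + Y \<in> S \<and> X ** Y \<in> S \<and> X ** Y = Y ** X) \<and>
     (\<forall>c. \<forall>X\<in>S. mat c ** X \<in> S)"

definition maximal_comm_subalgebra :: "(complex^'d^'d) set \<Rightarrow> bool" where
  "maximal_comm_subalgebra S \<longleftrightarrow>
     comm_subalgebra S \<and> (\<forall>S'. comm_subalgebra S' \<and> S \<subseteq> S' \<longrightarrow> S' = S)"

definition ker_mat :: "complex^'d^'d \<Rightarrow> (complex^'d) set" where
  "ker_mat A = {x. A *v x = 0}"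

text \<open>An n x n block matrix with d x d blocks is represented as a function
  nat => nat => block, with block indices p, q < n (zero outside the range).
  The block Toeplitz matrix with symbol T is (T (p - q)) for p, q < n.\<close>

definition block_toeplitz :: "nat \<Rightarrow> (int \<Rightarrow> complex^'d^'d) \<Rightarrow> (nat \<Rightarrow> nat \<Rightarrow> complex^'d^'d)" where
  "block_toeplitz n T = (\<lambda>p q. if p < n \<and> q < n then T (int p - int q) else 0)"

definition F_set :: "nat \<Rightarrow> (complex^'d^'d) set \<Rightarrow> complex^'d^'d \<Rightarrow> complex^'d^'d
    \<Rightarrow> (nat \<Rightarrow> nat \<Rightarrow> complex^'d^'d) set" where
  "F_set n \<A> A B = {block_toeplitz n T | T.
      (\<forall>j. - (int n - 1) \<le> j \<and> j \<le> int n - 1 \<longrightarrow> T j \<in> \<A>) \<and>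
      (\<forall>j. 1 \<le> j \<and> j \<le> int n - 1 \<longrightarrow> A ** T j = B ** T (j - int n))}"

end

theory Submission
  imports Defs
begin

text \<open>If \<open>A\<close> and \<open>B\<close> commute and have no common kernel vector, then every solution
  of \<open>A x = B y\<close> is of the form \<open>x = B w\<close>, \<open>y = A w\<close>. Granting this, if \<open>A B' = A' B\<close>
  and \<open>A T\<^sub>j = B T\<^sub>j\<^sub>-\<^sub>n\<close>, then writing \<open>T\<^sub>j v = B w\<close>, \<open>T\<^sub>j\<^sub>-\<^sub>n v = A w\<close> gives
  \<open>A' T\<^sub>j v = A' B w = B' A w = B' T\<^sub>j\<^sub>-\<^sub>n v\<close>, so the two classes coincide. Conversely,
  the Toeplitz matrix with \<open>T\<^sub>1 = B\<close>, \<open>T\<^sub>1\<^sub>-\<^sub>n = A\<close> and all other symbols zero lies in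
  \<open>\<F>\<^sub>A\<^sub>,\<^sub>B\<close>; membership in \<open>\<F>\<^sub>A\<^sub>'\<^sub>,\<^sub>B\<^sub>'\<close> forces \<open>A' B = B' A\<close>.\<close>

lemma vec_inj_on_endo_subspace_imp_image_eq:
  fixes f :: "'a::field^'n \<Rightarrow> 'a^'n"
  assumes "Vector_Spaces.linear (*s) (*s) f" and "vec.subspace K"
    and "f ` K \<subseteq> K" and "inj_on f K"
  shows "f ` K = K"
proof -
  have "vec.span K = K" using \<open>vec.subspace K\<close> vec.span_eq_iff by blast
  then have "vec.dim (f ` K) = vec.dim K"
    using vec.dim_image_eq[OF assms(1), of K] \<open>inj_on f K\<close> by metis
  then show ?thesis
    using vec.subspace_dim_equal[OF vec.linear_subspace_image[OF assms(1,2)] assms(2,3)] by simp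
qed

lemma ker_mat_inter_eq_zero_iff:
  "ker_mat A \<inter> ker_mat B = {0} \<longleftrightarrow> (\<forall>v. A *v v = 0 \<longrightarrow> B *v v = 0 \<longrightarrow> v = 0)"
  unfolding ker_mat_def by auto

lemma commuting_kernel_in_image:
  fixes A B :: "'a::field^'n^'n"
  assumes comm: "A ** B = B ** A"
    and ker: "\<And>v. A *v v = 0 \<Longrightarrow> B *v v = 0 \<Longrightarrow> v = 0"
    and U: "vec.subspace U" and BU: "(*v) B ` U \<subseteq> U"
    and k: "k \<in> U" "A *v k = 0"
  shows "\<exists>v\<in>U. A *v v = 0 \<and> B *v v = k"
proof -
  define K where "K = U \<inter> {v. A *v v = 0}"
  have K: "vec.subspace K"
    unfolding K_def by (intro vec.subspace_inter U vec.subspace_kernel)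
  have "(*v) B ` K \<subseteq> K"
  proof
    fix z assume "z \<in> (*v) B ` K"
    then obtain v where v: "v \<in> K" "z = B *v v" by auto
    have "A *v z = B *v (A *v v)" using v comm by (simp add: matrix_vector_mul_assoc)
    then show "z \<in> K" using v BU unfolding K_def by auto
  qed
  moreover have "inj_on ((*v) B) K"
  proof (rule inj_onI)
    fix u v assume uv: "u \<in> K" "v \<in> K" "B *v u = B *v v"
    then have "A *v (u - v) = 0" "B *v (u - v) = 0"
      unfolding K_def by (simp_all add: vec.diff)
    then show "u = v" using ker by force
  qed
  ultimately have "(*v) B ` K = K"
    by (intro vec_inj_on_endo_subspace_imp_image_eq matrix_vector_mul_linear_gen K)
  moreover have "k \<in> K" using k unfolding K_def by simp
  ultimately obtain v where "v \<in> K" "B *v v = k" by force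
  then show ?thesis unfolding K_def by auto
qed

text \<open>Induction on the dimension of a subspace invariant under \<open>A\<close> and \<open>B\<close>: one first
  solves \<open>A u = y\<close> inside the smaller invariant subspace \<open>A U\<close>, then corrects \<open>u\<close> by a
  kernel vector of \<open>A\<close> using the previous lemma.\<close>

lemma commuting_lift_in_invariant_subspace:
  fixes A B :: "'a::field^'n^'n"
  assumes comm: "A ** B = B ** A"
    and ker: "\<And>v. A *v v = 0 \<Longrightarrow> B *v v = 0 \<Longrightarrow> v = 0"
  shows "vec.subspace U \<Longrightarrow> (*v) A ` U \<subseteq> U \<Longrightarrow> (*v) B ` U \<subseteq> U \<Longrightarrow> x \<in> U \<Longrightarrow> y \<in> U
    \<Longrightarrow> A *v x = B *v y \<Longrightarrow> \<exists>w\<in>U. B *v w = x \<and> A *v w = y"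
proof (induction "vec.dim U" arbitrary: U x y rule: less_induct)
  case less
  have "\<exists>u\<in>U. A *v u = y"
  proof (cases "(*v) A ` U = U")
    case True
    then show ?thesis using less.prems by force
  next
    case False
    let ?AU = "(*v) A ` U"
    have AU: "vec.subspace ?AU" by (rule vec.subspace_image[OF less.prems(1)])
    have "vec.dim ?AU < vec.dim U"
    proof -
      have "?AU \<subset> U" using False less.prems(2) by auto
      then have "vec.span ?AU \<subset> vec.span U"
        using AU less.prems(1) vec.span_eq_iff by metis
      then show ?thesis by (rule vec.dim_psubset)
    qed
    moreover have "(*v) A ` ?AU \<subseteq> ?AU" using less.prems(2) by auto
    moreover have "(*v) B ` ?AU \<subseteq> ?AU"
    proof
      fix z assume "z \<in> (*v) B ` ?AU"
      then obtain u where u: "u \<in> U" "z = B *v (A *v u)" by auto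
      then have "z = A *v (B *v u)" using comm by (simp add: matrix_vector_mul_assoc)
      then show "z \<in> ?AU" using u less.prems(3) by auto
    qed
    moreover have "A *v (A *v x) = B *v (A *v y)"
      using less.prems(6) comm by (simp add: matrix_vector_mul_assoc)
    ultimately obtain w where w: "w \<in> ?AU" "B *v w = A *v x" "A *v w = A *v y"
      using less.hyps[OF _ AU] less.prems(4,5) by blast
    have "A *v (w - y) = 0" "B *v (w - y) = 0"
      using w less.prems(6) by (simp_all add: vec.diff)
    then have "w = y" using ker by force
    then show ?thesis using w(1) by auto
  qed
  then obtain u where u: "u \<in> U" "A *v u = y" by auto
  have "B *v u - x \<in> U"
    using u less.prems by (intro vec.subspace_diff) auto
  moreover have "A *v (B *v u - x) = 0"
    using u less.prems(6) comm
    by (simp add: vec.diff matrix_vector_mul_assoc flip: matrix_vector_mul_assoc[of B A])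
  ultimately obtain v where v: "v \<in> U" "A *v v = 0" "B *v v = B *v u - x"
    using commuting_kernel_in_image[OF comm ker less.prems(1,3)] by blast
  show ?case
    by (rule bexI[of _ "u - v"])
      (use u v less.prems in \<open>auto simp: vec.diff intro: vec.subspace_diff\<close>)
qed

lemma commuting_lift:
  fixes A B :: "'a::field^'n^'n"
  assumes "A ** B = B ** A"
    and "\<And>v. A *v v = 0 \<Longrightarrow> B *v v = 0 \<Longrightarrow> v = 0"
    and "A *v x = B *v y"
  obtains w where "B *v w = x" and "A *v w = y"
  using commuting_lift_in_invariant_subspace[OF assms(1,2), of UNIV x y] assms(3) by auto

lemma F_set_subset_if_cross_eq:
  fixes A B A' B' :: "complex^'d^'d"
  assumes S: "comm_subalgebra \<A>"
    and mem: "A \<in> \<A>" "B \<in> \<A>" "B' \<in> \<A>"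
    and ker: "\<And>v. A *v v = 0 \<Longrightarrow> B *v v = 0 \<Longrightarrow> v = 0"
    and cross: "A ** B' = A' ** B"
  shows "F_set n \<A> A B \<subseteq> F_set n \<A> A' B'"
proof
  have comm: "\<And>X Y. X \<in> \<A> \<Longrightarrow> Y \<in> \<A> \<Longrightarrow> X ** Y = Y ** X"
    using S unfolding comm_subalgebra_def by blast
  fix M assume "M \<in> F_set n \<A> A B"
  then obtain T where M: "M = block_toeplitz n T"
    and T_mem: "\<forall>j. - (int n - 1) \<le> j \<and> j \<le> int n - 1 \<longrightarrow> T j \<in> \<A>"
    and T_rel: "\<forall>j. 1 \<le> j \<and> j \<le> int n - 1 \<longrightarrow> A ** T j = B ** T (j - int n)"
    unfolding F_set_def by blast
  have "A' ** T j = B' ** T (j - int n)" if j: "1 \<le> j" "j \<le> int n - 1" for j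
  proof -
    have "(A' ** T j) *v v = (B' ** T (j - int n)) *v v" for v
    proof -
      have "A *v (T j *v v) = B *v (T (j - int n) *v v)"
        using T_rel j by (simp add: matrix_vector_mul_assoc)
      then obtain w where w: "B *v w = T j *v v" "A *v w = T (j - int n) *v v"
        using commuting_lift[OF comm[OF mem(1,2)] ker] by blast
      have "(A' ** T j) *v v = (A' ** B) *v w"
        by (simp add: w flip: matrix_vector_mul_assoc)
      also have "\<dots> = (B' ** A) *v w" using cross comm[OF mem(1,3)] by simp
      also have "\<dots> = (B' ** T (j - int n)) *v v"
        by (simp add: w flip: matrix_vector_mul_assoc)
      finally show ?thesis .
    qed
    then show ?thesis by (simp add: matrix_eq)
  qed
  then show "M \<in> F_set n \<A> A' B'" unfolding F_set_def using M T_mem by blast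
qed

lemma cross_eq_if_F_set_subset:
  fixes A B A' B' :: "complex^'d^'d"
  assumes "n \<ge> 2" and S: "comm_subalgebra \<A>" and mem: "A \<in> \<A>" "B \<in> \<A>"
    and sub: "F_set n \<A> A B \<subseteq> F_set n \<A> A' B'"
  shows "A' ** B = B' ** A"
proof -
  have AB: "A ** B = B ** A" and zero: "0 \<in> \<A>"
    using S mem unfolding comm_subalgebra_def by blast+
  define T :: "int \<Rightarrow> complex^'d^'d" where
    "T = (\<lambda>j. if j = 1 then B else if j = 1 - int n then A else 0)"
  have "block_toeplitz n T \<in> F_set n \<A> A B"
    unfolding F_set_def
  proof (intro CollectI exI conjI allI impI)
    show "block_toeplitz n T = block_toeplitz n T" ..
  next
    fix j :: int
    show "T j \<in> \<A>" unfolding T_def using mem zero by auto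
  next
    fix j :: int assume "1 \<le> j \<and> j \<le> int n - 1"
    then show "A ** T j = B ** T (j - int n)"
      using AB \<open>n \<ge> 2\<close> by (auto simp: T_def)
  qed
  with sub obtain T' where T': "block_toeplitz n T = block_toeplitz n T'"
    and T'_rel: "\<forall>j. 1 \<le> j \<and> j \<le> int n - 1 \<longrightarrow> A' ** T' j = B' ** T' (j - int n)"
    unfolding F_set_def by blast
  have "T' 1 = B"
    using fun_cong[OF fun_cong[OF T', of 1], of 0] \<open>n \<ge> 2\<close>
    by (simp add: block_toeplitz_def T_def)
  moreover have "T' (1 - int n) = A"
    using fun_cong[OF fun_cong[OF T', of 0], of "n - 1"] \<open>n \<ge> 2\<close>
    by (simp add: block_toeplitz_def T_def of_nat_diff)
  ultimately show ?thesis using T'_rel \<open>n \<ge> 2\<close> by force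
qed

theorem theorem4p6:
  fixes n :: nat and \<A> :: "(complex^'d^'d) set" and A B A' B' :: "complex^'d^'d"
  assumes "n \<ge> 2"
    and "maximal_comm_subalgebra \<A>"
    and "A \<in> \<A>" "B \<in> \<A>" "A' \<in> \<A>" "B' \<in> \<A>"
    and "ker_mat A \<inter> ker_mat B = {0}"
    and "ker_mat A' \<inter> ker_mat B' = {0}"
  shows "F_set n \<A> A B = F_set n \<A> A' B' \<longleftrightarrow> A ** B' = A' ** B"
proof
  have S: "comm_subalgebra \<A>"
    using assms(2) unfolding maximal_comm_subalgebra_def by blast
  show "A ** B' = A' ** B" if "F_set n \<A> A B = F_set n \<A> A' B'"
  proof -
    have "A' ** B = B' ** A"
      using cross_eq_if_F_set_subset[OF assms(1) S assms(3,4)] that by blast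
    then show ?thesis using S assms(3,6) unfolding comm_subalgebra_def by metis
  qed
  show "F_set n \<A> A B = F_set n \<A> A' B'" if cross: "A ** B' = A' ** B"
  proof
    show "F_set n \<A> A B \<subseteq> F_set n \<A> A' B'"
      using F_set_subset_if_cross_eq[OF S assms(3,4,6) _ cross] assms(7)
      by (simp add: ker_mat_inter_eq_zero_iff)
    show "F_set n \<A> A' B' \<subseteq> F_set n \<A> A B"
      using F_set_subset_if_cross_eq[OF S assms(5,6,4) _ cross[symmetric]] assms(8)
      by (simp add: ker_mat_inter_eq_zero_iff)
  qed
qed

end
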